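(* Let $n\ge1$ be an integer, $\lambda_s,\lambda_e>0$ and $\lambda_g\ge 0$. For the fully connected network of $n$ nodes with rate-changing gossip at the source and at all gossiping nodes ($FC_{allRC}$), the long-term average freshness of every node $i$ is $$\overline{F}_i^{FC_{allRC}}=\frac{1}{n}\sum_{k=1}^{n}\prod_{j=1}^{k}\frac{\lambda_s+(j-1)\lambda_g}{\lambda_s+(j-1)\lambda_g+\lambda_e}.$$
   Context: A source self-updates according to a Poisson process of rate $\lambda_e$, and $n$ nodes track it. A node is fresh at time $t$ ($F_i(t)=1$) if it holds the current version of the source's information, and stale ($F_i(t)=0$) otherwise. The long-term average freshness of node $i$ is $\overline{F}_i=\limsup_{T\to\infty}\frac1T\mathbb{E}\big[\int_0^T F_i(t)\,dt\big]$. In the fully connected network with rate-changing gossip everywhere ($FC_{allRC}$), the source splits its total update rate $\lambda_s$ equally among the currently stale nodes, and each fresh node likewise splits its total gossip rate $\lambda_g$ equally among the currently stale nodes. So, when $\ell<n$ nodes are fresh, each stale node receives updates from the source at rate $\lambda_s/(n-\ell)$ and from each of the $\ell$ fresh nodes at rate $\lambda_g/(n-\ell)$. Equivalently, the set $S(t)\subseteq\{1,\dots,n\}$ of fresh nodes is a continuous-time Markov chain with the following transitions: - from any $S$, at rate $\lambda_e$ the source self-updates and the state becomes $\emptyset$ (all nodes stale); - from $S$ with $|S|<n$, for each $i\notin S$, at rate $\frac{\lambda_s+|S|\lambda_g}{n-|S|}$ the state becomes $S\cup\{i\}$. All nodes are stale at time $0$, and $F_i(t)=\mathbb{I}_{\{i\in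 S(t)\}}$. *)

theory Defs
  imports "HOL-Probability.Probability"
begin

definition transition_function :: "'s set \<Rightarrow> (real \<Rightarrow> 's \<Rightarrow> 's \<Rightarrow> real) \<Rightarrow> bool" where
  "transition_function E p \<longleftrightarrow>
     (\<forall>t\<ge>0. \<forall>x\<in>E. \<forall>y\<in>E. 0 \<le> p t x y) \<and>
     (\<forall>t\<ge>0. \<forall>x\<in>E. (\<Sum>y\<in>E. p t x y) = 1) \<and>
     (\<forall>x\<in>E. \<forall>y\<in>E. p 0 x y = (if x = y then 1 else 0)) \<and>
     (\<forall>s\<ge>0. \<forall>t\<ge>0. \<forall>x\<in>E. \<forall>y\<in>E. p (s + t) x y = (\<Sum>z\<in>E. p s x z * p t z y))"

(* Only r x y with x ~= y matters: a "transition" from x to x does not change the state. *)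
definition generator_of_rates :: "'s set \<Rightarrow> ('s \<Rightarrow> 's \<Rightarrow> real) \<Rightarrow> 's \<Rightarrow> 's \<Rightarrow> real" where
  "generator_of_rates E r x y = (if x = y then - (\<Sum>z\<in>E - {x}. r x z) else r x y)"

(* Time-homogeneous continuous-time Markov chain with finite state space E, jump rates r and
   right-continuous paths (E being discrete, a path is constant for a while from any time on).
   Times are nonnegative; X t is irrelevant for t < 0. In the Markov property, J and f describe
   an arbitrary finite part of the history up to time t; the conditional probabilities are
   constrained only when the conditioning event has positive probability. *)
locale finite_ctmc = prob_space M
  for M :: "'w measure" and E :: "'s set" and r :: "'s \<Rightarrow> 's \<Rightarrow> real" and X :: "real \<Rightarrow> 'w \<Rightarrow> 's" +
  assumes finite_states: "finite E"
    and measurable_X: "t \<ge> 0 \<Longrightarrow> X t \<in> measurable M (count_space E)"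
    and right_continuous_paths:
      "w \<in> space M \<Longrightarrow> t \<ge> 0 \<Longrightarrow> \<exists>e>0. \<forall>s\<in>{t..<t + e}. X s w = X t w"
    and markov:
      "\<exists>p. transition_function E p \<and>
         (\<forall>x\<in>E. \<forall>y\<in>E. ((\<lambda>h. p h x y) has_real_derivative generator_of_rates E r x y)
                          (at 0 within {0..})) \<and>
         (\<forall>t\<ge>0. \<forall>h\<ge>0. \<forall>x\<in>E. \<forall>y\<in>E. \<forall>J f.
            finite J \<and> J \<subseteq> {0..t} \<and>
            \<P>(w in M. X t w = x \<and> (\<forall>s\<in>J. X s w = f s)) > 0 \<longrightarrow>
            \<P>(w in M. X (t + h) w = y \<bar> X t w = x \<and> (\<forall>s\<in>J. X s w = f s)) = p h x y)"

(* The state is the set of fresh nodes. The first summand is the self-update of the source, the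
   second one collects, for every stale node i, its becoming fresh. *)
definition FC_allRC_rate :: "nat \<Rightarrow> real \<Rightarrow> real \<Rightarrow> real \<Rightarrow> nat set \<Rightarrow> nat set \<Rightarrow> real" where
  "FC_allRC_rate n lambda_s lambda_g lambda_e A B =
     (if B = {} then lambda_e else 0) +
     (\<Sum>i\<in>{1..n} - A. if B = insert i A
        then (lambda_s + real (card A) * lambda_g) / (real n - real (card A)) else 0)"

locale FC_allRC = finite_ctmc M "Pow {1..n}" "FC_allRC_rate n lambda_s lambda_g lambda_e" S
  for M :: "'w measure" and n :: nat and lambda_s lambda_g lambda_e :: real and S :: "real \<Rightarrow> 'w \<Rightarrow> nat set" +
  assumes initially_stale: "AE w in M. S 0 w = {}"

definition freshness :: "(real \<Rightarrow> 'w \<Rightarrow> nat set) \<Rightarrow> nat \<Rightarrow> real \<Rightarrow> 'w \<Rightarrow> real" where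
  "freshness S i t w = (if i \<in> S t w then 1 else 0)"

(* The limsup over real T tending to infinity is taken in the extended reals. *)
definition avg_freshness :: "'w measure \<Rightarrow> (real \<Rightarrow> 'w \<Rightarrow> nat set) \<Rightarrow> nat \<Rightarrow> ereal" where
  "avg_freshness M S i =
     Limsup at_top (\<lambda>T::real.
       ereal (1 / T * (LINT w|M. (LINT t:{0..T}|lborel. freshness S i t w))))"

end

theory Submission
  imports Defs
begin

text \<open>Let \<open>Q\<close> be the generator. If \<open>f = c + Q g\<close>, then the expected time integral of \<open>f\<close> up to \<open>T\<close>
  is \<open>c T\<close> plus the increment of the expectation of \<open>g\<close>, which is bounded; so the long-run average
  of \<open>f\<close> is \<open>c\<close>, without any appeal to stationarity or ergodicity. For \<open>f\<close> the freshness of node \<open>i\<close>,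
  the function \<open>- lambda_e g\<close> is the probability that \<open>i\<close> is fresh when the source next updates itself.
  This is \<open>1\<close> if \<open>i\<close> is fresh already; if \<open>l\<close> nodes are fresh but \<open>i\<close> is not, it is \<open>V l / (n - l)\<close>
  by symmetry, where \<open>V l\<close> is the expected number of nodes that become fresh before the update. The
  next event being a delivery with probability \<open>q (Suc l)\<close>, \<open>V l = q (Suc l) * (1 + V (Suc l))\<close>.\<close>

section \<open>Transition functions on a finite state space and the forward equation\<close>

lemma transition_function_le_1:
  assumes "finite E" "transition_function E p" "t \<ge> 0" "x \<in> E" "y \<in> E"
  shows "p t x y \<le> 1"
proof -
  have "p t x y \<le> (\<Sum>z\<in>E. p t x z)"
    using assms unfolding transition_function_def by (intro member_le_sum) auto
  then show ?thesis
    using assms unfolding transition_function_def by auto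
qed

text \<open>Chapman-Kolmogorov at \<open>s + h\<close> minus the same at \<open>s + 0\<close>.
  Increments at time \<open>s\<close> thus become averages of increments at time 0, where the
  generator governs them.\<close>

lemma transition_function_diff:
  assumes "finite E" "transition_function E p" "s \<ge> 0" "h \<ge> 0" "x \<in> E" "y \<in> E"
  shows "p (s + h) x y - p s x y = (\<Sum>z\<in>E. p s x z * (p h z y - p 0 z y))"
proof -
  have ck: "\<And>a b. a \<ge> 0 \<Longrightarrow> b \<ge> 0 \<Longrightarrow> p (a + b) x y = (\<Sum>z\<in>E. p a x z * p b z y)"
    using assms unfolding transition_function_def by auto
  show ?thesis
    using ck[of s h] ck[of s 0] assms by (simp add: right_diff_distrib sum_subtractf)
qed

text \<open>Chapman-Kolmogorov only runs forward, so the increment is always taken from the earlier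
  time. Writing it with \<open>min s t\<close> and the elapsed time covers both sides of
  \<open>t\<close> by one formula, which reduces the two-sided derivative at \<open>t\<close> to the
  right derivative at 0.\<close>

lemma transition_function_diff_quotient:
  assumes "finite E" "transition_function E p" "s \<ge> 0" "t \<ge> 0" "s \<noteq> t" "x \<in> E" "y \<in> E"
  shows "(p s x y - p t x y) / (s - t) =
    (\<Sum>z\<in>E. p (min s t) x z * ((p \<bar>s - t\<bar> z y - p 0 z y) / \<bar>s - t\<bar>))"
proof (cases "s < t")
  case True
  then have "(p s x y - p t x y) / (s - t) = (p (s + (t - s)) x y - p s x y) / (t - s)"
    using minus_divide_divide[of "p s x y - p t x y" "s - t"] by simp
  also have "\<dots> = (\<Sum>z\<in>E. p s x z * (p (t - s) z y - p 0 z y)) / (t - s)"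
    using assms True by (subst transition_function_diff) auto
  finally show ?thesis
    using True by (simp add: sum_divide_distrib)
next
  case False
  then have "(p s x y - p t x y) / (s - t) = (p (t + (s - t)) x y - p t x y) / (s - t)"
    by simp
  also have "\<dots> = (\<Sum>z\<in>E. p t x z * (p (s - t) z y - p 0 z y)) / (s - t)"
    using assms False by (subst transition_function_diff) auto
  finally show ?thesis
    using False by (simp add: sum_divide_distrib)
qed

text \<open>The substitution of \<open>\<bar>s - t\<bar>\<close> for \<open>h\<close> turns limits
  at 0 from the right into two-sided limits at \<open>t\<close>.\<close>

lemma filterlim_abs_diff_at_0:
  fixes t :: real
  shows "filterlim (\<lambda>s. \<bar>s - t\<bar>) (at 0 within {0..}) (at t within A)"
  unfolding filterlim_at
  by (auto simp: eventually_at_filter intro!: tendsto_eq_intros)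

lemma transition_function_continuous:
  assumes E: "finite E" "transition_function E p" and x: "x \<in> E" and y: "y \<in> E"
    and cont: "\<And>z. z \<in> E \<Longrightarrow> ((\<lambda>h. p h z y) \<longlongrightarrow> p 0 z y) (at 0 within {0..})"
  shows "continuous_on {0..} (\<lambda>t. p t x y)"
proof -
  have "((\<lambda>s. p s x y) \<longlongrightarrow> p t x y) (at t within {0..})" if t: "t \<ge> 0" for t
  proof -
    have lim: "((\<lambda>s. \<Sum>z\<in>E. \<bar>p \<bar>s - t\<bar> z y - p 0 z y\<bar>) \<longlongrightarrow> 0) (at t within {0..})"
    proof (rule tendsto_null_sum)
      fix z assume "z \<in> E"
      from filterlim_compose[OF cont[OF this] filterlim_abs_diff_at_0]
      have "((\<lambda>s. p \<bar>s - t\<bar> z y - p 0 z y) \<longlongrightarrow> 0) (at t within {0..})"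
        by (rule LIM_zero)
      then show "((\<lambda>s. \<bar>p \<bar>s - t\<bar> z y - p 0 z y\<bar>) \<longlongrightarrow> 0) (at t within {0..})"
        by (rule tendsto_rabs_zero)
    qed
    have bound: "norm (p s x y - p t x y) \<le> (\<Sum>z\<in>E. \<bar>p \<bar>s - t\<bar> z y - p 0 z y\<bar>)"
      if s: "s \<ge> 0" for s
    proof -
      define m where "m = min s t"
      have m: "m \<ge> 0" using s t by (simp add: m_def)
      have "\<bar>p s x y - p t x y\<bar> = \<bar>p (m + \<bar>s - t\<bar>) x y - p m x y\<bar>"
        by (auto simp: m_def min_def abs_if)
      also have "\<dots> = \<bar>\<Sum>z\<in>E. p m x z * (p \<bar>s - t\<bar> z y - p 0 z y)\<bar>"
        using E m x y by (subst transition_function_diff) auto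
      also have "\<dots> \<le> (\<Sum>z\<in>E. \<bar>p m x z * (p \<bar>s - t\<bar> z y - p 0 z y)\<bar>)"
        by (rule sum_abs)
      also have "\<dots> \<le> (\<Sum>z\<in>E. \<bar>p \<bar>s - t\<bar> z y - p 0 z y\<bar>)"
      proof (rule sum_mono)
        fix z assume z: "z \<in> E"
        have "0 \<le> p m x z" "p m x z \<le> 1"
          using E m x z transition_function_le_1[OF E m x z]
          by (auto simp: transition_function_def)
        then show "\<bar>p m x z * (p \<bar>s - t\<bar> z y - p 0 z y)\<bar> \<le> \<bar>p \<bar>s - t\<bar> z y - p 0 z y\<bar>"
          by (simp add: abs_mult mult_left_le_one_le)
      qed
      finally show ?thesis by simp
    qed
    have "((\<lambda>s. p s x y - p t x y) \<longlongrightarrow> 0) (at t within {0..})"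
      by (rule Lim_null_comparison[OF _ lim]) (use bound in \<open>auto simp: eventually_at_filter\<close>)
    then show ?thesis by (rule LIM_zero_cancel)
  qed
  then show ?thesis by (auto simp: continuous_on_def)
qed

text \<open>In the difference quotient above, the quotients at 0 tend to \<open>Q\<close>. To the
  left of \<open>t\<close> the weights \<open>p (min s t) x z\<close> move with \<open>s\<close>,
  which is why continuity has to come first.\<close>

lemma kolmogorov_forward:
  assumes E: "finite E" "transition_function E p" and x: "x \<in> E" and y: "y \<in> E" and t: "t \<ge> 0"
    and deriv: "\<And>z y. z \<in> E \<Longrightarrow> y \<in> E \<Longrightarrow>
      ((\<lambda>h. p h z y) has_real_derivative Q z y) (at 0 within {0..})"
  shows "((\<lambda>t. p t x y) has_real_derivative (\<Sum>z\<in>E. p t x z * Q z y)) (at t within {0..})"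
proof -
  have cont: "continuous_on {0..} (\<lambda>t. p t x z)" if z: "z \<in> E" for z
  proof (rule transition_function_continuous[OF E x z])
    fix z' assume "z' \<in> E"
    from DERIV_continuous[OF deriv[OF this z]]
    show "((\<lambda>h. p h z' z) \<longlongrightarrow> p 0 z' z) (at 0 within {0..})"
      by (simp add: continuous_within)
  qed
  have min_lim: "((\<lambda>s. p (min s t) x z) \<longlongrightarrow> p t x z) (at t within {0..})" if z: "z \<in> E" for z
  proof -
    have "continuous_on {0..} (\<lambda>s. p (min s t) x z)"
      by (rule continuous_on_compose2[OF cont[OF z]]) (use t in \<open>auto intro!: continuous_intros\<close>)
    then have "((\<lambda>s. p (min s t) x z) \<longlongrightarrow> p (min t t) x z) (at t within {0..})"
      using t unfolding continuous_on_def by blast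
    then show ?thesis by simp
  qed
  have quot_lim: "((\<lambda>s. (p \<bar>s - t\<bar> z y - p 0 z y) / \<bar>s - t\<bar>) \<longlongrightarrow> Q z y) (at t within {0..})"
    if z: "z \<in> E" for z
    using filterlim_compose[OF _ filterlim_abs_diff_at_0, of "\<lambda>h. (p h z y - p 0 z y) / h"]
      deriv[OF z y] by (simp add: has_field_derivative_iff)
  have "((\<lambda>s. \<Sum>z\<in>E. p (min s t) x z * ((p \<bar>s - t\<bar> z y - p 0 z y) / \<bar>s - t\<bar>)) \<longlongrightarrow>
      (\<Sum>z\<in>E. p t x z * Q z y)) (at t within {0..})"
    by (intro tendsto_sum tendsto_mult min_lim quot_lim)
  moreover have "\<forall>\<^sub>F s in at t within {0..}.
      (\<Sum>z\<in>E. p (min s t) x z * ((p \<bar>s - t\<bar> z y - p 0 z y) / \<bar>s - t\<bar>)) =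
      (p s x y - p t x y) / (s - t)"
    using transition_function_diff_quotient[OF E _ t _ x y] by (simp add: eventually_at_filter)
  ultimately show ?thesis
    unfolding has_field_derivative_iff by (rule Lim_transform_eventually)
qed

section \<open>Expectations and time averages along a finite chain\<close>

context finite_ctmc
begin

text \<open>Joint measurability in path and time is what Fubini will ask for. It follows from
  right-continuity: the process is a pointwise limit of step processes that change only on a grid.
  The indicator removes negative times, at which \<open>X\<close> is arbitrary.\<close>

lemma measurable_paths:
  fixes f :: "'s \<Rightarrow> real"
  shows "(\<lambda>(w, t). indicator {0..T} t * f (X t w)) \<in> borel_measurable (M \<Otimes>\<^sub>M lborel)"
proof -
  \<comment> \<open>For \<open>t \<ge> 0\<close>, \<open>grid k (idx k t)\<close> is the right end
    point of the grid cell containing \<open>t\<close>. The \<open>Suc j\<close> in the numerator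
    selects the right end, since paths are controlled only at times after \<open>t\<close>.\<close>
  define grid where "grid k j = real (Suc j) / real (Suc k)" for k j :: nat
  define idx where "idx k t = nat \<lfloor>t * real (Suc k)\<rfloor>" for k and t :: real
  let ?F = "\<lambda>k (w, t :: real). indicator {0..T} t * f (X (grid k (idx k t)) w)"
  show ?thesis
  proof (rule borel_measurable_LIMSEQ_real[where u = ?F])
    fix a :: "'w \<times> real" assume a: "a \<in> space (M \<Otimes>\<^sub>M lborel)"
    obtain w t where wt: "a = (w, t)" by (cases a)
    with a have w: "w \<in> space M" by (auto simp: space_pair_measure)
    show "(\<lambda>k. ?F k a) \<longlonglongrightarrow> (case a of (w, t) \<Rightarrow> indicator {0..T} t * f (X t w))"
    proof (cases "t \<ge> 0")
      case True
      obtain e where e: "e > 0" "\<And>s. s \<in> {t..<t + e} \<Longrightarrow> X s w = X t w"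
        using right_continuous_paths[OF w True] by blast
      have "(\<lambda>k. 1 / real (Suc k)) \<longlonglongrightarrow> 0"
        using LIMSEQ_inverse_real_of_nat by (simp add: inverse_eq_divide)
      then have "\<forall>\<^sub>F k in sequentially. 1 / real (Suc k) < e"
        using e by (simp add: order_tendstoD)
      then have "\<forall>\<^sub>F k in sequentially. ?F k a = indicator {0..T} t * f (X t w)"
      proof eventually_elim
        case (elim k)
        have "real (idx k t) \<le> t * real (Suc k)" "t * real (Suc k) < real (idx k t) + 1"
          using True by (auto simp: idx_def)
        then have "t \<le> grid k (idx k t)" "grid k (idx k t) \<le> t + 1 / real (Suc k)"
          by (simp_all add: grid_def pos_le_divide_eq pos_divide_le_eq distrib_right del: of_nat_Suc)
        with elim have "X (grid k (idx k t)) w = X t w"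
          by (intro e) auto
        then show ?case using wt by simp
      qed
      then show ?thesis using wt by (simp add: tendsto_eventually)
    next
      case False
      then show ?thesis using wt by simp
    qed
  next
    fix k
    have X: "X (grid k j) \<in> measurable M (count_space E)" for j
      by (rule measurable_X) (simp add: grid_def)
    have f: "f \<in> borel_measurable (count_space E)" by simp
    have [measurable]: "(\<lambda>w. f (X (grid k j) w)) \<in> borel_measurable M" for j
      using measurable_compose[OF X f] .
    have [measurable]: "idx k \<in> measurable borel (count_space UNIV)"
      unfolding idx_def by measurable
    \<comment> \<open>For fixed \<open>k\<close> only countably many times are sampled, so
      measurability of each single \<open>X (grid k j)\<close> suffices.\<close>
    have [measurable]: "(\<lambda>a. f (X (grid k (idx k (snd a))) (fst a))) \<in> borel_measurable (M \<Otimes>\<^sub>M lborel)"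
      by (rule measurable_compose_countable[where g = "\<lambda>a. idx k (snd a)"]) measurable
    show "?F k \<in> borel_measurable (M \<Otimes>\<^sub>M lborel)"
      unfolding case_prod_beta by measurable
  qed
qed

text \<open>Fubini applies because \<open>f\<close> is bounded on the finite set \<open>E\<close>
  and \<open>space M \<times> {0..T}\<close> has finite measure.\<close>

lemma expectation_time_integral:
  fixes f :: "'s \<Rightarrow> real"
  shows "(LINT w|M. (LINT t:{0..T}|lborel. f (X t w))) =
    (LINT t:{0..T}|lborel. expectation (\<lambda>w. f (X t w)))"
proof -
  interpret pair_sigma_finite M lborel ..
  define C where "C = (\<Sum>x\<in>E. \<bar>f x\<bar>)"
  have C: "\<bar>f (X t w)\<bar> \<le> C" if "w \<in> space M" "t \<ge> 0" for t w
    using measurable_space[OF measurable_X[OF that(2)] that(1)] finite_states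
    unfolding C_def by (intro member_le_sum) auto
  have "integrable (M \<Otimes>\<^sub>M lborel) (\<lambda>(w, t). indicator {0..T} t * f (X t w))"
  proof (rule integrableI_bounded_set[where A = "space M \<times> {0..T}" and B = C])
    show "space M \<times> {0..T} \<in> sets (M \<Otimes>\<^sub>M lborel)" by measurable
    have "emeasure (M \<Otimes>\<^sub>M lborel) (space M \<times> {0..T}) = emeasure M (space M) * emeasure lborel {0..T}"
      by (rule lborel.emeasure_pair_measure_Times) auto
    then show "emeasure (M \<Otimes>\<^sub>M lborel) (space M \<times> {0..T}) < \<infinity>"
      by (simp add: emeasure_space_1 emeasure_lborel_Icc_eq)
    show "AE a in M \<Otimes>\<^sub>M lborel. a \<in> space M \<times> {0..T} \<longrightarrow>
        norm (case a of (w, t) \<Rightarrow> indicator {0..T} t * f (X t w)) \<le> C"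
      using C by (intro AE_I2) auto
    show "AE a in M \<Otimes>\<^sub>M lborel. a \<notin> space M \<times> {0..T} \<longrightarrow>
        (case a of (w, t) \<Rightarrow> indicator {0..T} t * f (X t w)) = 0"
      by (intro AE_I2) (auto simp: space_pair_measure indicator_def)
  qed (rule measurable_paths)
  from Fubini_integral[OF this]
  have "(LINT t|lborel. LINT w|M. indicator {0..T} t * f (X t w)) =
    (LINT w|M. LINT t|lborel. indicator {0..T} t * f (X t w))" .
  then show ?thesis
    by (simp add: set_lebesgue_integral_def)
qed

lemma expectation_eq_sum:
  fixes f :: "'s \<Rightarrow> real"
  assumes "t \<ge> 0"
  shows "expectation (\<lambda>w. f (X t w)) = (\<Sum>y\<in>E. \<P>(w in M. X t w = y) * f y)"
proof -
  note X = measurable_X[OF assms]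
  have sets: "{w \<in> space M. X t w = y} \<in> events" if "y \<in> E" for y
    using measurable_sets[OF X, of "{y}"] that by (simp add: vimage_def Int_def conj_commute)
  have "expectation (\<lambda>w. f (X t w)) =
      expectation (\<lambda>w. \<Sum>y\<in>E. indicator {w \<in> space M. X t w = y} w * f y)"
  proof (rule Bochner_Integration.integral_cong[OF refl])
    fix w assume w: "w \<in> space M"
    then have "X t w \<in> E" using measurable_space[OF X] by auto
    then show "f (X t w) = (\<Sum>y\<in>E. indicator {w \<in> space M. X t w = y} w * f y)"
      using w finite_states by (simp add: indicator_def sum.delta if_distrib[of "\<lambda>c. c * _"] cong: if_cong)
  qed
  also have "\<dots> = (\<Sum>y\<in>E. expectation (\<lambda>w. indicator {w \<in> space M. X t w = y} w * f y))"
    using sets by (intro Bochner_Integration.integral_sum integrable_mult_left) (auto simp: emeasure_eq_measure)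
  also have "\<dots> = (\<Sum>y\<in>E. \<P>(w in M. X t w = y) * f y)"
    using sets by simp
  finally show ?thesis .
qed

text \<open>Conditioning on the almost sure event that the chain starts in \<open>x\<close> does not
  change probabilities, so the Markov property at time 0 with empty history gives the law at time
  \<open>t\<close>.\<close>

lemma prob_state_from_initial:
  assumes init: "AE w in M. X 0 w = x" and x: "x \<in> E"
    and trans: "\<forall>t\<ge>0. \<forall>h\<ge>0. \<forall>x\<in>E. \<forall>y\<in>E. \<forall>J f.
      finite J \<and> J \<subseteq> {0..t} \<and>
      \<P>(w in M. X t w = x \<and> (\<forall>s\<in>J. X s w = f s)) > 0 \<longrightarrow>
      \<P>(w in M. X (t + h) w = y \<bar> X t w = x \<and> (\<forall>s\<in>J. X s w = f s)) = p h x y"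
    and t: "t \<ge> 0" and y: "y \<in> E"
  shows "\<P>(w in M. X t w = y) = p t x y"
proof -
  have sets: "{w \<in> space M. X s w = z} \<in> events" if "s \<ge> 0" "z \<in> E" for s z
    using measurable_sets[OF measurable_X[OF that(1)], of "{z}"] that
    by (simp add: vimage_def Int_def conj_commute)
  have one: "\<P>(w in M. X 0 w = x) = 1"
    using init sets[OF order_refl x] by (simp add: prob_Collect_eq_1)
  have "{w \<in> space M. X t w = y \<and> X 0 w = x} = {w \<in> space M. X t w = y} \<inter> {w \<in> space M. X 0 w = x}"
    by auto
  then have "{w \<in> space M. X t w = y \<and> X 0 w = x} \<in> events"
    using sets[OF t y] sets[OF order_refl x] by auto
  then have "\<P>(w in M. X t w = y \<and> X 0 w = x) = \<P>(w in M. X t w = y)"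
    using init sets[OF t y] by (intro finite_measure_eq_AE) auto
  then have "\<P>(w in M. X t w = y \<bar> X 0 w = x) = \<P>(w in M. X t w = y)"
    by (simp add: cond_prob_def one)
  moreover have "\<P>(w in M. X t w = y \<bar> X 0 w = x) = p t x y"
    using trans[rule_format, of 0 t x y "{}" undefined] t x y one by simp
  ultimately show ?thesis by simp
qed

lemma time_average_of_poisson_equation:
  fixes f g :: "'s \<Rightarrow> real"
  assumes init: "AE w in M. X 0 w = x" and x: "x \<in> E"
    and poisson: "\<And>z. z \<in> E \<Longrightarrow> f z = c + (\<Sum>y\<in>E. generator_of_rates E r z y * g y)"
  shows "((\<lambda>T. 1 / T * (LINT w|M. (LINT t:{0..T}|lborel. f (X t w)))) \<longlongrightarrow> c) at_top"
proof -
  let ?Q = "generator_of_rates E r"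
  obtain p where p: "transition_function E p"
    and deriv: "\<forall>x\<in>E. \<forall>y\<in>E.
      ((\<lambda>h. p h x y) has_real_derivative ?Q x y) (at 0 within {0..})"
    and trans: "\<forall>t\<ge>0. \<forall>h\<ge>0. \<forall>x\<in>E. \<forall>y\<in>E. \<forall>J f.
      finite J \<and> J \<subseteq> {0..t} \<and>
      \<P>(w in M. X t w = x \<and> (\<forall>s\<in>J. X s w = f s)) > 0 \<longrightarrow>
      \<P>(w in M. X (t + h) w = y \<bar> X t w = x \<and> (\<forall>s\<in>J. X s w = f s)) = p h x y"
    using markov by (elim exE conjE) (rule that)
  note forward = kolmogorov_forward[OF finite_states p x _ _ deriv[rule_format]]
  \<comment> \<open>\<open>u t\<close> is the expectation of \<open>g\<close> at time
    \<open>t\<close> for the chain started in \<open>x\<close>.\<close>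
  define u where "u t = (\<Sum>y\<in>E. p t x y * g y)" for t
  have law: "expectation (\<lambda>w. f (X t w)) = (\<Sum>y\<in>E. p t x y * f y)" if t: "t \<ge> 0" for t
    using expectation_eq_sum[OF t] prob_state_from_initial[OF init x trans t] by simp
  \<comment> \<open>By the forward equation \<open>u\<close> has as derivative the expectation of
    \<open>Q g\<close>. Since the rows of \<open>p\<close> sum to 1, averaging the Poisson equation
    turns this plus \<open>c\<close> into the expectation of \<open>f\<close>, so
    \<open>c * t + u t\<close> is an antiderivative of it.\<close>
  have der: "((\<lambda>t. c * t + u t) has_real_derivative (\<Sum>y\<in>E. p t x y * f y)) (at t within {0..})"
    if t: "t \<ge> 0" for t
  proof -
    have "((\<lambda>t. c * t + u t) has_real_derivative
        (c + (\<Sum>y\<in>E. (\<Sum>z\<in>E. p t x z * ?Q z y) * g y))) (at t within {0..})"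
      unfolding u_def by (rule derivative_eq_intros DERIV_sum forward t | assumption | simp)+
    moreover have "(\<Sum>y\<in>E. p t x y * f y) = c + (\<Sum>y\<in>E. (\<Sum>z\<in>E. p t x z * ?Q z y) * g y)"
    proof -
      have "(\<Sum>y\<in>E. p t x y * f y) =
          (\<Sum>z\<in>E. p t x z) * c + (\<Sum>z\<in>E. \<Sum>y\<in>E. p t x z * ?Q z y * g y)"
        by (simp add: poisson distrib_left sum.distrib sum_distrib_left sum_distrib_right mult.assoc)
      also have "(\<Sum>z\<in>E. p t x z) = 1"
        using p t x unfolding transition_function_def by auto
      also have "(\<Sum>z\<in>E. \<Sum>y\<in>E. p t x z * ?Q z y * g y) =
          (\<Sum>y\<in>E. (\<Sum>z\<in>E. p t x z * ?Q z y) * g y)"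
        by (subst sum.swap) (simp add: sum_distrib_right)
      finally show ?thesis by simp
    qed
    ultimately show ?thesis by simp
  qed
  have cont: "continuous_on {0..} (\<lambda>t. p t x y)" if "y \<in> E" for y
    using forward[OF that] by (intro DERIV_continuous_on) auto
  have integral: "(LINT w|M. (LINT t:{0..T}|lborel. f (X t w))) = c * T + u T - u 0"
    if T: "T \<ge> 0" for T
  proof -
    have "(LINT w|M. (LINT t:{0..T}|lborel. f (X t w))) =
        (LINT t:{0..T}|lborel. (\<Sum>y\<in>E. p t x y * f y))"
      unfolding expectation_time_integral by (intro set_lebesgue_integral_cong) (auto simp: law)
    also have "\<dots> = (c * T + u T) - (c * 0 + u 0)"
      unfolding set_lebesgue_integral_def
    proof (rule integral_FTC_Icc[OF T])
      fix t assume "0 \<le> t" "t \<le> T"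
      then show "((\<lambda>t. c * t + u t) has_vector_derivative (\<Sum>y\<in>E. p t x y * f y)) (at t within {0..T})"
        using der[of t] by (intro has_vector_derivative_within_subset[where S = "{0..}" and T = "{0..T}"])
          (auto simp: has_real_derivative_iff_has_vector_derivative)
    next
      show "continuous_on {0..T} (\<lambda>t. \<Sum>y\<in>E. p t x y * f y)"
        by (intro continuous_intros continuous_on_subset[OF cont]) auto
    qed
    finally show ?thesis by simp
  qed
  have u_bound: "\<bar>u t\<bar> \<le> (\<Sum>y\<in>E. \<bar>g y\<bar>)" if t: "t \<ge> 0" for t
  proof -
    have "\<bar>u t\<bar> \<le> (\<Sum>y\<in>E. \<bar>p t x y * g y\<bar>)"
      unfolding u_def by (rule sum_abs)
    also have "\<dots> \<le> (\<Sum>y\<in>E. \<bar>g y\<bar>)"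
    proof (rule sum_mono)
      fix y assume y: "y \<in> E"
      have "0 \<le> p t x y" "p t x y \<le> 1"
        using p t x y transition_function_le_1[OF finite_states p t x y]
        by (auto simp: transition_function_def)
      then show "\<bar>p t x y * g y\<bar> \<le> \<bar>g y\<bar>"
        by (simp add: abs_mult mult_left_le_one_le)
    qed
    finally show ?thesis .
  qed
  have "((\<lambda>T. (u T - u 0) / T) \<longlongrightarrow> 0) at_top"
  proof (rule Lim_null_comparison)
    show "((\<lambda>T. 2 * (\<Sum>y\<in>E. \<bar>g y\<bar>) / T) \<longlongrightarrow> 0) at_top"
      by (intro tendsto_divide_0[OF tendsto_const] filterlim_at_top_imp_at_infinity filterlim_ident)
    show "\<forall>\<^sub>F T in at_top. norm ((u T - u 0) / T) \<le> 2 * (\<Sum>y\<in>E. \<bar>g y\<bar>) / T"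
      using eventually_gt_at_top[of 0]
    proof eventually_elim
      case (elim T)
      then show ?case
        using u_bound[of T] u_bound[of 0] by (auto simp: abs_divide intro!: divide_right_mono)
    qed
  qed
  then have "((\<lambda>T. c + (u T - u 0) / T) \<longlongrightarrow> c) at_top"
    using tendsto_add[OF tendsto_const] by fastforce
  moreover have "\<forall>\<^sub>F T in at_top. c + (u T - u 0) / T =
      1 / T * (LINT w|M. (LINT t:{0..T}|lborel. f (X t w)))"
    using eventually_gt_at_top[of 0]
    by eventually_elim (simp add: integral field_simps)
  ultimately show ?thesis by (rule Lim_transform_eventually)
qed

end

section \<open>The gossip chain and its Poisson equation\<close>

lemma generator_of_rates_sum:
  assumes "finite E" "x \<in> E"
  shows "(\<Sum>y\<in>E. generator_of_rates E r x y * g y) = (\<Sum>y\<in>E. r x y * (g y - g x))"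
proof -
  have "(\<Sum>y\<in>E. generator_of_rates E r x y * g y) =
      - (\<Sum>y\<in>E - {x}. r x y) * g x + (\<Sum>y\<in>E - {x}. generator_of_rates E r x y * g y)"
    by (subst sum.remove[OF assms]) (simp add: generator_of_rates_def)
  also have "(\<Sum>y\<in>E - {x}. generator_of_rates E r x y * g y) = (\<Sum>y\<in>E - {x}. r x y * g y)"
    by (intro sum.cong refl) (auto simp: generator_of_rates_def)
  also have "- (\<Sum>y\<in>E - {x}. r x y) * g x + \<dots> = (\<Sum>y\<in>E - {x}. r x y * (g y - g x))"
    by (simp add: right_diff_distrib sum_subtractf sum_distrib_right)
  \<comment> \<open>The summand for \<open>y = x\<close> is 0 whatever \<open>r x x\<close> is; for
    the gossip chain this rate is \<open>lambda_e\<close> at the empty set.\<close>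
  also have "\<dots> = (\<Sum>y\<in>E. r x y * (g y - g x))"
    using sum.remove[OF assms, of "\<lambda>y. r x y * (g y - g x)"] by simp
  finally show ?thesis .
qed

text \<open>Summing over events instead of target states: after the sums are exchanged, each event
  (self-update or delivery to \<open>j\<close>) contributes only through the one state it leads
  to.\<close>

lemma FC_allRC_generator:
  assumes A: "A \<subseteq> {1..n}"
  shows "(\<Sum>B\<in>Pow {1..n}. generator_of_rates (Pow {1..n})
      (FC_allRC_rate n lambda_s lambda_g lambda_e) A B * g B) =
    lambda_e * (g {} - g A) + (\<Sum>j\<in>{1..n} - A.
      (lambda_s + real (card A) * lambda_g) / (real n - real (card A)) * (g (insert j A) - g A))"
proof -
  let ?m = "(lambda_s + real (card A) * lambda_g) / (real n - real (card A))"
  have "(\<Sum>B\<in>Pow {1..n}. FC_allRC_rate n lambda_s lambda_g lambda_e A B * (g B - g A)) =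
      (\<Sum>B\<in>Pow {1..n}. if B = {} then lambda_e * (g B - g A) else 0) +
      (\<Sum>B\<in>Pow {1..n}. \<Sum>j\<in>{1..n} - A. if B = insert j A then ?m * (g B - g A) else 0)"
    unfolding FC_allRC_rate_def
    by (simp add: distrib_right sum.distrib sum_distrib_right if_distrib[of "\<lambda>c. c * _"] cong: if_cong)
  also have "(\<Sum>B\<in>Pow {1..n}. if B = {} then lambda_e * (g B - g A) else 0) = lambda_e * (g {} - g A)"
    by (simp add: sum.delta)
  also have "(\<Sum>B\<in>Pow {1..n}. \<Sum>j\<in>{1..n} - A. if B = insert j A then ?m * (g B - g A) else 0) =
      (\<Sum>j\<in>{1..n} - A. \<Sum>B\<in>Pow {1..n}. if B = insert j A then ?m * (g B - g A) else 0)"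
    by (rule sum.swap)
  also have "\<dots> = (\<Sum>j\<in>{1..n} - A. ?m * (g (insert j A) - g A))"
    using A by (intro sum.cong refl) (simp add: sum.delta)
  finally show ?thesis
    using A by (subst generator_of_rates_sum) auto
qed

text \<open>All products share the factor \<open>q (Suc l)\<close>; the summand for
  \<open>k = Suc l\<close> has nothing else and yields the 1.\<close>

lemma sum_prod_tail_rec:
  fixes q :: "nat \<Rightarrow> real"
  assumes "l < n"
  shows "(\<Sum>k\<in>{l<..n}. \<Prod>j\<in>{l<..k}. q j) = q (Suc l) * (1 + (\<Sum>k\<in>{Suc l<..n}. \<Prod>j\<in>{Suc l<..k}. q j))"
proof -
  have step: "{l<..k} = insert (Suc l) {Suc l<..k}" if "l < k" for k
    using that by auto
  have "(\<Sum>k\<in>{l<..n}. \<Prod>j\<in>{l<..k}. q j) = q (Suc l) + (\<Sum>k\<in>{Suc l<..n}. \<Prod>j\<in>{l<..k}. q j)"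
    using assms by (simp add: step)
  also have "(\<Sum>k\<in>{Suc l<..n}. \<Prod>j\<in>{l<..k}. q j) = (\<Sum>k\<in>{Suc l<..n}. q (Suc l) * (\<Prod>j\<in>{Suc l<..k}. q j))"
    by (intro sum.cong refl) (simp add: step)
  finally show ?thesis
    by (simp add: sum_distrib_left distrib_left)
qed

lemma FC_allRC_poisson_equation:
  fixes lambda_s lambda_g lambda_e :: real and V :: "nat \<Rightarrow> real"
  assumes pos: "lambda_s > 0" "lambda_e > 0" "lambda_g \<ge> 0" and i: "i \<in> {1..n}" and A: "A \<subseteq> {1..n}"
    and V_n: "V n = 0"
    and V_rec: "\<And>l. l < n \<Longrightarrow> V l = (lambda_s + real l * lambda_g) /
      (lambda_s + real l * lambda_g + lambda_e) * (1 + V (Suc l))"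
    and g: "g = (\<lambda>B. - (if i \<in> B then 1 else V (card B) / (real n - real (card B))) / lambda_e)"
  shows "(if i \<in> A then 1 else 0) = V 0 / real n + (\<Sum>B\<in>Pow {1..n}. generator_of_rates (Pow {1..n})
      (FC_allRC_rate n lambda_s lambda_g lambda_e) A B * g B)"
proof (cases "i \<in> A")
  case True
  \<comment> \<open>Deliveries keep \<open>i\<close> fresh and leave \<open>g\<close> unchanged.
    Only the self-update contributes, namely
    \<open>lambda_e * (g {} - g A) = 1 - V 0 / real n\<close>.\<close>
  then show ?thesis
    using pos unfolding FC_allRC_generator[OF A] by (simp add: g field_simps)
next
  case False
  have fin: "finite A" using A finite_subset by blast
  define l where "l = card A"
  have "card A < card {1..n}"
    using A False i by (intro psubset_card_mono) auto
  then have l: "l < n" by (simp add: l_def)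
  define R where "R = lambda_s + real l * lambda_g"
  define d where "d = real n - real l"
  have d: "d > 0" using l by (simp add: d_def)
  have R: "R > 0" using pos by (simp add: R_def add_pos_nonneg)
  have rest: "real (card ({1..n} - A - {i})) = d - 1"
    using A False i fin l
    by (simp add: card_Diff_subset l_def d_def of_nat_diff)
  have g_i: "g (insert i A) = - 1 / lambda_e" and g_A: "g A = - (V l / d) / lambda_e"
    and g_0: "g {} = - (V 0 / real n) / lambda_e"
    using False by (simp_all add: g l_def d_def)
  have g_j: "g (insert j A) = - (V (Suc l) / (d - 1)) / lambda_e" if "j \<in> {1..n} - A - {i}" for j
    using that False fin by (simp add: g l_def d_def algebra_simps)
  \<comment> \<open>The delivery to \<open>i\<close> itself makes \<open>i\<close> fresh and is
    split off. The other \<open>d - 1\<close> deliveries leave \<open>i\<close> stale and all lead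
    to the same value of \<open>g\<close>.\<close>
  have "(\<Sum>j\<in>{1..n} - A. R / d * (g (insert j A) - g A)) =
      R / d * (g (insert i A) - g A) + (\<Sum>j\<in>{1..n} - A - {i}. R / d * (g (insert j A) - g A))"
    using i False by (intro sum.remove) auto
  also have "(\<Sum>j\<in>{1..n} - A - {i}. R / d * (g (insert j A) - g A)) =
      (\<Sum>j\<in>{1..n} - A - {i}. R / d * (- (V (Suc l) / (d - 1)) / lambda_e - g A))"
    by (intro sum.cong refl) (simp add: g_j)
  also have "\<dots> = (d - 1) * (R / d * (- (V (Suc l) / (d - 1)) / lambda_e - g A))"
    using rest by simp
  also have "\<dots> = R / d * (- V (Suc l) / lambda_e - (d - 1) * g A)"
  \<comment> \<open>If \<open>i\<close> is the only stale node, \<open>V (Suc l) / (d - 1)\<close>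
    divides by 0. The left side then vanishes through its factor \<open>d - 1\<close>, and the right
    side through \<open>V n = 0\<close>.\<close>
  proof (cases "d = 1")
    case True
    then have "Suc l = n" using l by (simp add: d_def)
    then show ?thesis using True V_n by simp
  next
    case False
    then show ?thesis using d pos by (simp add: field_simps)
  qed
  also have "R / d * (g (insert i A) - g A) + R / d * (- V (Suc l) / lambda_e - (d - 1) * g A) =
      - R / d * ((1 + V (Suc l)) - V l) / lambda_e"
    using d pos by (simp add: g_i g_A field_simps)
  \<comment> \<open>The recursion for \<open>V\<close> says that
    \<open>R * (1 + V (Suc l) - V l) = lambda_e * V l\<close>. The result cancels the term
    \<open>V l / d\<close> in the self-update contribution, leaving
    \<open>- V 0 / real n\<close>.\<close>
  also have "\<dots> = - V l / d"
  proof -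
    have "R * (1 + V (Suc l)) = V l * (R + lambda_e)"
      using V_rec[OF l] R pos by (simp add: R_def[symmetric])
    then show ?thesis using d pos by (simp add: field_simps)
  qed
  finally have "(\<Sum>j\<in>{1..n} - A. R / d * (g (insert j A) - g A)) = - V l / d" .
  then show ?thesis
    using False pos unfolding FC_allRC_generator[OF A] l_def[symmetric] R_def[symmetric] d_def[symmetric]
    by (simp add: g_0 g_A field_simps)
qed

theorem lemma3:
  fixes M :: "'w measure" and S :: "real \<Rightarrow> 'w \<Rightarrow> nat set"
    and n i :: nat and lambda_s lambda_g lambda_e :: real
  assumes "n \<ge> 1" and "lambda_s > 0" and "lambda_e > 0" and "lambda_g \<ge> 0"
    and "FC_allRC M n lambda_s lambda_g lambda_e S"
    and "i \<in> {1..n}"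
  shows "avg_freshness M S i =
    ereal (1 / real n * (\<Sum>k=1..n. \<Prod>j=1..k.
      (lambda_s + (real j - 1) * lambda_g) / (lambda_s + (real j - 1) * lambda_g + lambda_e)))"
proof -
  interpret FC_allRC M n lambda_s lambda_g lambda_e S by fact
  \<comment> \<open>With \<open>j - 1\<close> nodes fresh, the rates to the stale nodes add up to
    \<open>lambda_s + (real j - 1) * lambda_g\<close>, however many share them. So
    \<open>q j\<close> is the probability that the next event is a delivery.\<close>
  define q where "q j = (lambda_s + (real j - 1) * lambda_g) /
    (lambda_s + (real j - 1) * lambda_g + lambda_e)" for j :: nat
  \<comment> \<open>The product up to \<open>k\<close> is the probability that, from
    \<open>l\<close> fresh nodes, the number reaches \<open>k\<close> before the next self-update.
    Summing these tail probabilities gives the expected number of nodes that become fresh.\<close>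
  define V where "V l = (\<Sum>k\<in>{l<..n}. \<Prod>j\<in>{l<..k}. q j)" for l
  have V_n: "V n = 0" by (simp add: V_def)
  have V_rec: "V l = (lambda_s + real l * lambda_g) /
      (lambda_s + real l * lambda_g + lambda_e) * (1 + V (Suc l))" if "l < n" for l
    unfolding V_def sum_prod_tail_rec[OF that] by (simp add: q_def)
  have V_0: "V 0 = (\<Sum>k=1..n. \<Prod>j=1..k. q j)"
  proof -
    have "{0<..k} = {1..k}" for k :: nat by auto
    then show ?thesis by (simp add: V_def)
  qed
  define g where "g B = - (if i \<in> B then 1 else V (card B) / (real n - real (card B))) / lambda_e" for B
  have "((\<lambda>T. 1 / T * (LINT w|M. (LINT t:{0..T}|lborel. (if i \<in> S t w then 1 else 0)))) \<longlongrightarrow>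
      V 0 / real n) at_top"
  proof (rule time_average_of_poisson_equation[OF initially_stale])
    fix A assume "A \<in> Pow {1..n}"
    then show "(if i \<in> A then 1 else 0) = V 0 / real n + (\<Sum>B\<in>Pow {1..n}.
        generator_of_rates (Pow {1..n}) (FC_allRC_rate n lambda_s lambda_g lambda_e) A B * g B)"
      by (intro FC_allRC_poisson_equation[OF assms(2-4,6) _ V_n V_rec]) (auto simp: g_def)
  qed simp
  then have "((\<lambda>T. ereal (1 / T * (LINT w|M. (LINT t:{0..T}|lborel. freshness S i t w)))) \<longlongrightarrow>
      ereal (V 0 / real n)) at_top"
    unfolding freshness_def by (rule tendsto_ereal)
  \<comment> \<open>The time averages converge, so their upper limit is the limit.\<close>
  then have "avg_freshness M S i = ereal (V 0 / real n)"
    unfolding avg_freshness_def by (intro lim_imp_Limsup) auto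
  then show ?thesis
    unfolding V_0 q_def by simp
qed

end
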